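(* The following inequalities hold: $MC(F_4)\ge 6$, $MC(E_6)\ge 16$, $MC(E_7)\ge 27$, $MC(E_8)\ge 36$.
   Context: Let $\Delta$ be a finite irreducible crystallographic root system with a fixed positive system $\Delta^+$ and Weyl group $W$. For $w\in W$ set $N(w)=\{\alpha\in\Delta^+\mid w^{-1}(\alpha)\in-\Delta^+\}$. A subset $Y\subset W$ is inversion complete if $\bigcup_{w\in Y}N(w)=\Delta^+$; it is minimal inversion complete if it is inversion complete and no proper subset of $Y$ is inversion complete. If $\Delta$ is of type $T$, $MC(T)$ denotes the maximal cardinality of a minimal inversion complete subset of $W$. *)

theory Defs
  imports "HOL-Analysis.Analysis"
begin

section \<open>Root systems\<close>

definition cartan_integer :: "'a::euclidean_space \<Rightarrow> 'a \<Rightarrow> real" where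
  "cartan_integer \<beta> \<alpha> = 2 * (\<beta> \<bullet> \<alpha>) / (\<alpha> \<bullet> \<alpha>)"

definition root_reflection :: "'a::euclidean_space \<Rightarrow> 'a \<Rightarrow> 'a" where
  "root_reflection \<alpha> v = v - cartan_integer v \<alpha> *\<^sub>R \<alpha>"

definition crystallographic_root_system :: "'a::euclidean_space set \<Rightarrow> bool" where
  "crystallographic_root_system \<Delta> \<longleftrightarrow>
     finite \<Delta> \<and> 0 \<notin> \<Delta> \<and> span \<Delta> = UNIV \<and>
     (\<forall>\<alpha>\<in>\<Delta>. \<forall>c. c *\<^sub>R \<alpha> \<in> \<Delta> \<longrightarrow> c = 1 \<or> c = -1) \<and>
     (\<forall>\<alpha>\<in>\<Delta>. root_reflection \<alpha> ` \<Delta> = \<Delta>) \<and>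
     (\<forall>\<alpha>\<in>\<Delta>. \<forall>\<beta>\<in>\<Delta>. cartan_integer \<beta> \<alpha> \<in> \<int>)"

definition irreducible_roots :: "'a::euclidean_space set \<Rightarrow> bool" where
  "irreducible_roots \<Delta> \<longleftrightarrow> \<Delta> \<noteq> {} \<and>
     \<not> (\<exists>A B. A \<noteq> {} \<and> B \<noteq> {} \<and> A \<union> B = \<Delta> \<and> A \<inter> B = {} \<and>
            (\<forall>\<alpha>\<in>A. \<forall>\<beta>\<in>B. \<alpha> \<bullet> \<beta> = 0))"

text \<open>Positive systems are cut out by regular vectors, i.e. they correspond to Weyl chambers.\<close>

definition positive_system :: "'a::euclidean_space set \<Rightarrow> 'a set \<Rightarrow> bool" where
  "positive_system \<Delta> P \<longleftrightarrow>
     (\<exists>v. (\<forall>\<alpha>\<in>\<Delta>. \<alpha> \<bullet> v \<noteq> 0) \<and> P = {\<alpha>\<in>\<Delta>. \<alpha> \<bullet> v > 0})"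

definition simple_roots :: "'a::euclidean_space set \<Rightarrow> 'a set" where
  "simple_roots P = {\<alpha>\<in>P. \<not> (\<exists>\<beta>\<in>P. \<exists>\<gamma>\<in>P. \<alpha> = \<beta> + \<gamma>)}"

inductive_set weyl_group :: "'a::euclidean_space set \<Rightarrow> ('a \<Rightarrow> 'a) set" for \<Delta> where
  weyl_id: "id \<in> weyl_group \<Delta>"
| weyl_reflection: "w \<in> weyl_group \<Delta> \<Longrightarrow> \<alpha> \<in> \<Delta> \<Longrightarrow> root_reflection \<alpha> \<circ> w \<in> weyl_group \<Delta>"

section \<open>Types of root systems\<close>

datatype root_type = F4 | E6 | E7 | E8

fun type_rank :: "root_type \<Rightarrow> nat" where
  "type_rank F4 = 4"
| "type_rank E6 = 6"
| "type_rank E7 = 7"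
| "type_rank E8 = 8"

text \<open>Cartan matrices with Bourbaki's labelling of the simple roots by 1, 2, ...; the diagrams
  of type E6 and E7 are the full subdiagrams of that of type E8 on the first 6 and 7 nodes.\<close>

definition E_edges :: "nat set set" where
  "E_edges = {{1,3}, {3,4}, {2,4}, {4,5}, {5,6}, {6,7}, {7,8}}"

definition F4_edges :: "nat set set" where
  "F4_edges = {{1,2}, {2,3}, {3,4}}"

definition cartan_matrix :: "root_type \<Rightarrow> nat \<Rightarrow> nat \<Rightarrow> int" where
  "cartan_matrix T i j =
     (if i = j then 2
      else if T = F4 then
        (if i = 2 \<and> j = 3 then -2 else if {i, j} \<in> F4_edges then -1 else 0)
      else (if {i, j} \<in> E_edges then -1 else 0))"

definition has_type :: "'a::euclidean_space set \<Rightarrow> root_type \<Rightarrow> bool" where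
  "has_type P T \<longleftrightarrow>
     (\<exists>s. bij_betw s {1..type_rank T} (simple_roots P) \<and>
          (\<forall>i\<in>{1..type_rank T}. \<forall>j\<in>{1..type_rank T}.
             cartan_integer (s i) (s j) = of_int (cartan_matrix T i j)))"

definition irreducible_root_system_of_type ::
    "root_type \<Rightarrow> 'a::euclidean_space set \<Rightarrow> 'a set \<Rightarrow> bool" where
  "irreducible_root_system_of_type T \<Delta> P \<longleftrightarrow>
     crystallographic_root_system \<Delta> \<and> irreducible_roots \<Delta> \<and>
     positive_system \<Delta> P \<and> has_type P T"

section \<open>Inversion complete sets\<close>

definition inversion_set :: "'a::euclidean_space set \<Rightarrow> ('a \<Rightarrow> 'a) \<Rightarrow> 'a set" where
  "inversion_set P w = {\<alpha>\<in>P. inv w \<alpha> \<in> uminus ` P}"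

definition inversion_complete ::
    "'a::euclidean_space set \<Rightarrow> 'a set \<Rightarrow> ('a \<Rightarrow> 'a) set \<Rightarrow> bool" where
  "inversion_complete \<Delta> P Y \<longleftrightarrow>
     Y \<subseteq> weyl_group \<Delta> \<and> (\<Union>w\<in>Y. inversion_set P w) = P"

definition minimal_inversion_complete ::
    "'a::euclidean_space set \<Rightarrow> 'a set \<Rightarrow> ('a \<Rightarrow> 'a) set \<Rightarrow> bool" where
  "minimal_inversion_complete \<Delta> P Y \<longleftrightarrow>
     inversion_complete \<Delta> P Y \<and> (\<forall>Z. Z \<subset> Y \<longrightarrow> \<not> inversion_complete \<Delta> P Z)"

definition MC :: "'a::euclidean_space set \<Rightarrow> 'a set \<Rightarrow> nat" where
  "MC \<Delta> P = Max {card Y | Y. minimal_inversion_complete \<Delta> P Y}"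

end

theory Submission
  imports Defs
begin

text \<open>For every vector \<open>x\<close> the set of positive roots \<open>\<gamma>\<close> with \<open>\<gamma> \<bullet> x < 0\<close> is the inversion set of
  some Weyl group element. Hence a set \<open>S\<close> of positive roots yields \<open>MC \<ge> card S\<close> as soon as every
  positive root is negative on some \<open>x\<close> that is negative on at most one element of \<open>S\<close>: the inversion
  sets meeting \<open>S\<close> at most once then cover all positive roots, and a minimal subcover needs a different
  one for each element of \<open>S\<close>.

  In the simply laced types with roots of squared length \<open>n\<close>, let \<open>\<omega>\<close> be a vector that is no root and
  has squared length at most \<open>n\<close>. Then \<open>S = {\<beta>. 2 (\<beta> \<bullet> \<omega>) \<ge> n}\<close> works, with \<open>x = \<omega> - \<gamma>\<close> for the root \<open>\<gamma>\<close>.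
  Minuscule fundamental weights for E6 and E7 and half the second fundamental weight for E8 give 16, 27
  and 36 roots (the maximal abelian ideals). For F4 six roots and six vectors \<open>x\<close> are given
  explicitly.\<close>

section \<open>Reflections and the Weyl group\<close>

lemma linear_root_reflection: "linear (root_reflection \<alpha>)"
  by (rule linearI)
    (simp_all add: root_reflection_def cartan_integer_def algebra_simps
      add_divide_distrib)

lemma inner_root_reflection:
  assumes "\<alpha> \<noteq> 0"
  shows "root_reflection \<alpha> x \<bullet> root_reflection \<alpha> y = x \<bullet> y"
  using assms
  by (simp add: root_reflection_def cartan_integer_def inner_diff_left inner_diff_right
      inner_commute field_simps)

lemma root_reflection_idem:
  assumes "\<alpha> \<noteq> 0"
  shows "root_reflection \<alpha> (root_reflection \<alpha> x) = x"
  using assms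
  by (simp add: root_reflection_def cartan_integer_def inner_diff_left scaleR_diff_left [symmetric])

text \<open>Keeping the regular vector \<open>v\<close> gives a height function on the roots, and
  its images \<open>w v\<close> represent the chambers.\<close>

locale root_chamber =
  fixes \<Delta> P :: "'a::euclidean_space set" and v :: 'a
  assumes crystallographic: "crystallographic_root_system \<Delta>"
    and regular: "\<And>\<alpha>. \<alpha> \<in> \<Delta> \<Longrightarrow> \<alpha> \<bullet> v \<noteq> 0"
    and positive: "P = {\<alpha> \<in> \<Delta>. \<alpha> \<bullet> v > 0}"
begin

lemma finite_roots: "finite \<Delta>"
  and span_roots: "span \<Delta> = UNIV"
  and root_reflection_image: "\<alpha> \<in> \<Delta> \<Longrightarrow> root_reflection \<alpha> ` \<Delta> = \<Delta>"
  and cartan_integer_Ints: "\<lbrakk>\<alpha> \<in> \<Delta>; \<beta> \<in> \<Delta>\<rbrakk> \<Longrightarrow> cartan_integer \<beta> \<alpha> \<in> \<int>"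
  and reduced: "\<lbrakk>\<alpha> \<in> \<Delta>; c *\<^sub>R \<alpha> \<in> \<Delta>\<rbrakk> \<Longrightarrow> c = 1 \<or> c = -1"
  using crystallographic by (simp_all add: crystallographic_root_system_def)

lemma root_nonzero: "\<alpha> \<in> \<Delta> \<Longrightarrow> \<alpha> \<noteq> 0"
  using regular by fastforce

lemma root_inner_pos: "\<alpha> \<in> \<Delta> \<Longrightarrow> \<alpha> \<bullet> \<alpha> > 0"
  using root_nonzero by simp

lemma root_reflection_in_roots: "\<lbrakk>\<alpha> \<in> \<Delta>; \<beta> \<in> \<Delta>\<rbrakk> \<Longrightarrow> root_reflection \<alpha> \<beta> \<in> \<Delta>"
  using root_reflection_image by blast

lemma uminus_root:
  assumes "\<alpha> \<in> \<Delta>"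
  shows "- \<alpha> \<in> \<Delta>"
proof -
  have "root_reflection \<alpha> \<alpha> = - \<alpha>"
    using root_nonzero [OF assms]
    by (simp add: root_reflection_def cartan_integer_def scaleR_2)
  then show ?thesis
    using root_reflection_in_roots [OF assms assms] by simp
qed

lemma finite_positive: "finite P"
  and positive_subset: "P \<subseteq> \<Delta>"
  and positive_inner: "\<alpha> \<in> P \<Longrightarrow> \<alpha> \<bullet> v > 0"
  using finite_roots by (auto simp: positive)

lemma positive_or_negative: "\<alpha> \<in> \<Delta> \<Longrightarrow> \<alpha> \<in> P \<or> - \<alpha> \<in> P"
  using regular [of \<alpha>] uminus_root [of \<alpha>] by (auto simp: positive)

lemma weyl_group_linear: "w \<in> weyl_group \<Delta> \<Longrightarrow> linear w"
proof (induction rule: weyl_group.induct)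
  case weyl_id
  show ?case by (rule linear_id)
next
  case (weyl_reflection w \<alpha>)
  then show ?case by (blast intro: linear_compose linear_root_reflection)
qed

lemma weyl_group_inner: "w \<in> weyl_group \<Delta> \<Longrightarrow> w x \<bullet> w y = x \<bullet> y"
  by (induction rule: weyl_group.induct) (auto simp: inner_root_reflection root_nonzero)

lemma weyl_group_bij: "w \<in> weyl_group \<Delta> \<Longrightarrow> bij w"
proof (induction rule: weyl_group.induct)
  case (weyl_reflection w \<alpha>)
  have "bij (root_reflection \<alpha>)"
    by (rule o_bij [of "root_reflection \<alpha>"])
      (auto simp: fun_eq_iff root_reflection_idem root_nonzero weyl_reflection)
  then show ?case using weyl_reflection by (blast intro: bij_comp)
qed (rule bij_id)

lemma weyl_group_image: "w \<in> weyl_group \<Delta> \<Longrightarrow> w ` \<Delta> = \<Delta>"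
proof (induction rule: weyl_group.induct)
  case (weyl_reflection w \<alpha>)
  then have "root_reflection \<alpha> ` w ` \<Delta> = \<Delta>" by (simp add: root_reflection_image)
  then show ?case by (simp add: image_comp)
qed simp

lemma root_preimage:
  assumes "w \<in> weyl_group \<Delta>" "\<alpha> \<in> \<Delta>"
  obtains \<beta> where "\<beta> \<in> \<Delta>" "\<alpha> = w \<beta>"
proof -
  have "\<alpha> \<in> w ` \<Delta>" by (simp add: assms weyl_group_image)
  then show ?thesis using that by blast
qed

text \<open>The roots span the space, so a linear \<open>w\<close> is determined by its values on
  the finite set \<Delta>, which it permutes.\<close>

lemma finite_weyl_group: "finite (weyl_group \<Delta>)"
proof (rule finite_imageD)
  show "finite ((\<lambda>w. restrict w \<Delta>) ` weyl_group \<Delta>)"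
  proof (rule finite_subset)
    show "(\<lambda>w. restrict w \<Delta>) ` weyl_group \<Delta> \<subseteq> \<Delta> \<rightarrow>\<^sub>E \<Delta>"
      by (auto dest!: weyl_group_image)
    show "finite (\<Delta> \<rightarrow>\<^sub>E \<Delta>)"
      by (simp add: finite_PiE finite_roots)
  qed
  show "inj_on (\<lambda>w. restrict w \<Delta>) (weyl_group \<Delta>)"
  proof (rule inj_onI)
    fix w u
    assume w: "w \<in> weyl_group \<Delta>" and u: "u \<in> weyl_group \<Delta>"
      and eq: "restrict w \<Delta> = restrict u \<Delta>"
    have "w \<alpha> = u \<alpha>" if "\<alpha> \<in> \<Delta>" for \<alpha>
      using fun_cong [OF eq, of \<alpha>] that by simp
    moreover have "x \<in> span \<Delta>" for x
      unfolding span_roots by (rule UNIV_I)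
    ultimately have "w x = u x" for x
      by (rule linear_eq_on_span [OF weyl_group_linear [OF w] weyl_group_linear [OF u]])
    then show "w = u" ..
  qed
qed

section \<open>Inversion sets as sign conditions\<close>

text \<open>Since \<open>w\<close> is an isometry, the preimage of a root pairs with
  \<open>v\<close> as the root itself pairs with \<open>w v\<close>; the sign decides whether the
  preimage is negative.\<close>

lemma inversion_set_eq:
  assumes "w \<in> weyl_group \<Delta>"
  shows "inversion_set P w = {\<alpha> \<in> P. \<alpha> \<bullet> w v < 0}"
proof -
  have "inv w \<alpha> \<in> uminus ` P \<longleftrightarrow> \<alpha> \<bullet> w v < 0" if "\<alpha> \<in> P" for \<alpha>
  proof -
    have "\<alpha> \<in> \<Delta>" using that positive_subset by (rule rev_subsetD)
    then obtain \<beta> where \<beta>: "\<beta> \<in> \<Delta>" "\<alpha> = w \<beta>"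
      by (rule root_preimage [OF assms])
    have "inv w \<alpha> = \<beta>"
      using weyl_group_bij [OF assms] \<beta> by (simp add: bij_is_inj)
    moreover have "\<alpha> \<bullet> w v = \<beta> \<bullet> v"
      using weyl_group_inner [OF assms] \<beta> by simp
    moreover have "\<beta> \<in> uminus ` P \<longleftrightarrow> - \<beta> \<in> P"
      by (metis (no_types) image_iff minus_minus)
    ultimately show ?thesis
      using uminus_root [OF \<beta>(1)] by (simp add: positive)
  qed
  then show ?thesis by (auto simp: inversion_set_def)
qed

text \<open>Among the Weyl group images of \<open>v\<close> take one with the largest inner product with \<open>x\<close>:
  comparing it with its mirror images shows that it lies in the chamber of \<open>x\<close>.\<close>

lemma inversion_set_of_regular:
  assumes "\<And>\<alpha>. \<alpha> \<in> \<Delta> \<Longrightarrow> \<alpha> \<bullet> x \<noteq> 0"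
  shows "\<exists>w\<in>weyl_group \<Delta>. inversion_set P w = {\<alpha> \<in> P. \<alpha> \<bullet> x < 0}"
proof -
  obtain w where w: "w \<in> weyl_group \<Delta>"
    and max: "\<And>u. u \<in> weyl_group \<Delta> \<Longrightarrow> u v \<bullet> x \<le> w v \<bullet> x"
  proof -
    have "weyl_group \<Delta> \<noteq> {}" using weyl_group.weyl_id by blast
    from ex_is_arg_min_if_finite [OF finite_weyl_group this, of "\<lambda>u. - (u v \<bullet> x)"]
    show ?thesis using that by (auto simp: is_arg_min_linorder)
  qed
  have "\<alpha> \<bullet> w v < 0 \<longleftrightarrow> \<alpha> \<bullet> x < 0" if "\<alpha> \<in> P" for \<alpha>
  proof -
    have \<alpha>: "\<alpha> \<in> \<Delta>" using that positive_subset by blast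
    have "root_reflection \<alpha> (w v) \<bullet> x \<le> w v \<bullet> x"
      using max [OF weyl_group.weyl_reflection [OF w \<alpha>]] by simp
    then have "0 \<le> cartan_integer (w v) \<alpha> * (\<alpha> \<bullet> x)"
      by (simp add: root_reflection_def inner_diff_left)
    \<comment> \<open>So \<open>x\<close> and \<open>w v\<close> lie weakly on the same side of the
      hyperplane of \<alpha>; as neither lies on it, the signs agree.\<close>
    then have "0 \<le> (\<alpha> \<bullet> w v) * (\<alpha> \<bullet> x)"
      using root_inner_pos [OF \<alpha>]
      by (simp add: cartan_integer_def inner_commute zero_le_mult_iff zero_le_divide_iff
          divide_le_0_iff)
    moreover have "\<alpha> \<bullet> w v \<noteq> 0"
    proof -
      obtain \<beta> where "\<beta> \<in> \<Delta>" "\<alpha> = w \<beta>" by (rule root_preimage [OF w \<alpha>])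
      then show ?thesis using weyl_group_inner [OF w] regular by simp
    qed
    ultimately show ?thesis
      using assms [OF \<alpha>] by (auto simp: zero_le_mult_iff)
  qed
  then show ?thesis using inversion_set_eq [OF w] w by (intro bexI [of _ w]) auto
qed

text \<open>A small push of \<open>x\<close> towards \<open>v\<close> makes it regular. Positive
  roots vanishing at \<open>x\<close> become positive, so no inversion is added; finiteness of
  \<Delta> gives one push that serves all roots.\<close>

lemma inversion_set_of_vector:
  shows "\<exists>w\<in>weyl_group \<Delta>. inversion_set P w = {\<alpha> \<in> P. \<alpha> \<bullet> x < 0}"
proof -
  have "\<forall>\<^sub>F e in at_right 0.
      \<alpha> \<bullet> (x + e *\<^sub>R v) \<noteq> 0 \<and> (\<alpha> \<bullet> x < 0 \<longrightarrow> \<alpha> \<bullet> (x + e *\<^sub>R v) < 0) \<and>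
      (\<alpha> \<in> P \<longrightarrow> \<alpha> \<bullet> x \<ge> 0 \<longrightarrow> \<alpha> \<bullet> (x + e *\<^sub>R v) > 0)" if "\<alpha> \<in> \<Delta>" for \<alpha>
  proof -
    have lim: "((\<lambda>e. \<alpha> \<bullet> (x + e *\<^sub>R v)) \<longlongrightarrow> \<alpha> \<bullet> x) (at_right (0::real))"
      by (auto intro!: tendsto_eq_intros)
    consider "\<alpha> \<bullet> x < 0" | "\<alpha> \<bullet> x = 0" | "\<alpha> \<bullet> x > 0" by linarith
    then show ?thesis
    proof cases
      case 1
      then show ?thesis using order_tendstoD(2) [OF lim, of 0] by (auto elim: eventually_mono)
    next
      case 2
      have "\<forall>\<^sub>F e in at_right (0::real). e > 0" by (rule eventually_at_right_less)
      then show ?thesis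
        by (rule eventually_mono)
          (use 2 regular [OF that] positive_inner in \<open>auto simp: inner_add_right\<close>)
    next
      case 3
      then show ?thesis using order_tendstoD(1) [OF lim, of 0] by (auto elim: eventually_mono)
    qed
  qed
  then have "\<forall>\<^sub>F e in at_right 0. \<forall>\<alpha>\<in>\<Delta>.
      \<alpha> \<bullet> (x + e *\<^sub>R v) \<noteq> 0 \<and> (\<alpha> \<bullet> x < 0 \<longrightarrow> \<alpha> \<bullet> (x + e *\<^sub>R v) < 0) \<and>
      (\<alpha> \<in> P \<longrightarrow> \<alpha> \<bullet> x \<ge> 0 \<longrightarrow> \<alpha> \<bullet> (x + e *\<^sub>R v) > 0)"
    by (simp add: eventually_ball_finite_distrib finite_roots)
  then obtain e where e: "\<And>\<alpha>. \<alpha> \<in> \<Delta> \<Longrightarrow> \<alpha> \<bullet> (x + e *\<^sub>R v) \<noteq> 0 \<and>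
      (\<alpha> \<bullet> x < 0 \<longrightarrow> \<alpha> \<bullet> (x + e *\<^sub>R v) < 0) \<and>
      (\<alpha> \<in> P \<longrightarrow> \<alpha> \<bullet> x \<ge> 0 \<longrightarrow> \<alpha> \<bullet> (x + e *\<^sub>R v) > 0)"
    using eventually_happens' [OF trivial_limit_at_right_real] by blast
  obtain w where "w \<in> weyl_group \<Delta>" "inversion_set P w = {\<alpha> \<in> P. \<alpha> \<bullet> (x + e *\<^sub>R v) < 0}"
    using inversion_set_of_regular [of "x + e *\<^sub>R v"] e by blast
  moreover have "{\<alpha> \<in> P. \<alpha> \<bullet> (x + e *\<^sub>R v) < 0} = {\<alpha> \<in> P. \<alpha> \<bullet> x < 0}"
    using e positive_subset by force
  ultimately show ?thesis by auto
qed

section \<open>The lower bound criterion\<close>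

lemma MC_ge_card:
  assumes S: "S \<subseteq> P"
    and ex: "\<And>\<gamma>. \<gamma> \<in> P \<Longrightarrow>
      \<exists>x. \<gamma> \<bullet> x < 0 \<and> (\<forall>\<alpha>\<in>S. \<forall>\<beta>\<in>S. \<alpha> \<bullet> x < 0 \<longrightarrow> \<beta> \<bullet> x < 0 \<longrightarrow> \<alpha> = \<beta>)"
  shows "MC \<Delta> P \<ge> card S"
proof -
  define X where "X = {w \<in> weyl_group \<Delta>.
      \<forall>\<alpha>\<in>S. \<forall>\<beta>\<in>S. \<alpha> \<in> inversion_set P w \<longrightarrow> \<beta> \<in> inversion_set P w \<longrightarrow> \<alpha> = \<beta>}"
  have "\<gamma> \<in> (\<Union>w\<in>X. inversion_set P w)" if \<gamma>: "\<gamma> \<in> P" for \<gamma>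
  proof -
    obtain x where x: "\<gamma> \<bullet> x < 0" "\<forall>\<alpha>\<in>S. \<forall>\<beta>\<in>S. \<alpha> \<bullet> x < 0 \<longrightarrow> \<beta> \<bullet> x < 0 \<longrightarrow> \<alpha> = \<beta>"
      using ex [OF \<gamma>] by blast
    obtain w where "w \<in> weyl_group \<Delta>" "inversion_set P w = {\<alpha> \<in> P. \<alpha> \<bullet> x < 0}"
      using inversion_set_of_vector by blast
    then have "w \<in> X" "\<gamma> \<in> inversion_set P w" using x \<gamma> by (simp_all add: X_def)
    then show ?thesis by blast
  qed
  then have "inversion_complete \<Delta> P X"
    by (auto simp: inversion_complete_def X_def inversion_set_def)
  moreover have "finite X"
    by (simp add: X_def finite_weyl_group)
  \<comment> \<open>Every subset of \<open>Y\<close> lies in \<open>X\<close> as well, so minimality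
    within \<open>X\<close> is minimality among all inversion complete sets.\<close>
  ultimately obtain Y where Y: "Y \<subseteq> X" "inversion_complete \<Delta> P Y"
      "\<And>Z. \<lbrakk>Z \<subseteq> X; inversion_complete \<Delta> P Z; Z \<subseteq> Y\<rbrakk> \<Longrightarrow> Z = Y"
    using finite_has_minimal2 [of "{Z. Z \<subseteq> X \<and> inversion_complete \<Delta> P Z}" X]
    by (metis (no_types, lifting) finite_Collect_subsets mem_Collect_eq order_refl rev_finite_subset subsetI)
  then have min: "minimal_inversion_complete \<Delta> P Y"
    unfolding minimal_inversion_complete_def by blast
  have "\<forall>\<beta>\<in>S. \<exists>w\<in>Y. \<beta> \<in> inversion_set P w"
    using Y(2) S by (auto simp: inversion_complete_def)
  \<comment> \<open>No element of \<open>X\<close> inverts two roots of \<open>S\<close>, which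
    makes this choice injective.\<close>
  then obtain f where f: "\<And>\<beta>. \<beta> \<in> S \<Longrightarrow> f \<beta> \<in> Y \<and> \<beta> \<in> inversion_set P (f \<beta>)"
    by metis
  have "inj_on f S"
  proof (rule inj_onI)
    fix \<alpha> \<beta> assume "\<alpha> \<in> S" "\<beta> \<in> S" "f \<alpha> = f \<beta>"
    moreover from this have "f \<alpha> \<in> X" using f Y(1) by blast
    ultimately show "\<alpha> = \<beta>" using f by (fastforce simp: X_def)
  qed
  moreover have "finite Y" using Y(1) \<open>finite X\<close> finite_subset by blast
  ultimately have "card S \<le> card Y"
    using f by (intro card_inj_on_le [of f]) auto
  also have "card Y \<le> MC \<Delta> P"
  proof -
    have "{card Y | Y. minimal_inversion_complete \<Delta> P Y} \<subseteq> card ` Pow (weyl_group \<Delta>)"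
      by (auto simp: minimal_inversion_complete_def inversion_complete_def)
    then have "finite {card Y | Y. minimal_inversion_complete \<Delta> P Y}"
      using finite_weyl_group finite_subset by blast
    then show ?thesis unfolding MC_def using min by (intro Max_ge) auto
  qed
  finally show ?thesis .
qed

section \<open>Generating the positive roots from the simple ones\<close>

lemma simple_root_positive: "\<alpha> \<in> simple_roots P \<Longrightarrow> \<alpha> \<in> P"
  by (simp add: simple_roots_def)

lemma simple_root_root: "\<alpha> \<in> simple_roots P \<Longrightarrow> \<alpha> \<in> \<Delta>"
  using simple_root_positive positive_subset by blast

lemma simple_root_not_sum: "\<lbrakk>\<beta> + \<gamma> \<in> simple_roots P; \<beta> \<in> P; \<gamma> \<in> P\<rbrakk> \<Longrightarrow> False"
  by (auto simp: simple_roots_def)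

text \<open>Heights are real numbers, so the number of positive roots of smaller height serves as
  the measure.\<close>

lemma positive_induct [consumes 1, case_names less]:
  assumes "\<gamma> \<in> P"
    and "\<And>\<gamma>. \<lbrakk>\<gamma> \<in> P; \<And>\<beta>. \<lbrakk>\<beta> \<in> P; \<beta> \<bullet> v < \<gamma> \<bullet> v\<rbrakk> \<Longrightarrow> Q \<beta>\<rbrakk> \<Longrightarrow> Q \<gamma>"
  shows "Q \<gamma>"
  using assms(1)
proof (induction "card {\<beta> \<in> P. \<beta> \<bullet> v < \<gamma> \<bullet> v}" arbitrary: \<gamma> rule: less_induct)
  case less
  have "Q \<beta>" if "\<beta> \<in> P" "\<beta> \<bullet> v < \<gamma> \<bullet> v" for \<beta>
  proof (rule less(1) [OF _ that(1)])
    have "{\<delta> \<in> P. \<delta> \<bullet> v < \<beta> \<bullet> v} \<subset> {\<delta> \<in> P. \<delta> \<bullet> v < \<gamma> \<bullet> v}"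
      using that by force
    then show "card {\<delta> \<in> P. \<delta> \<bullet> v < \<beta> \<bullet> v} < card {\<delta> \<in> P. \<delta> \<bullet> v < \<gamma> \<bullet> v}"
      by (intro psubset_card_mono) (auto simp: finite_positive)
  qed
  then show ?case using assms(2) less(2) by blast
qed

text \<open>Both summands of a decomposable positive root have smaller height. Taking for
  \<open>y\<close> the root itself shows that some simple root has positive inner product with
  it.\<close>

lemma positive_inner_nonpos:
  assumes "\<gamma> \<in> P" and "\<And>\<alpha>. \<alpha> \<in> simple_roots P \<Longrightarrow> \<alpha> \<bullet> y \<le> 0"
  shows "\<gamma> \<bullet> y \<le> 0"
  using assms(1)
proof (induction rule: positive_induct)
  case (less \<gamma>)
  show ?case
  proof (cases "\<gamma> \<in> simple_roots P")
    case False
    then obtain \<beta> \<delta> where "\<beta> \<in> P" "\<delta> \<in> P" "\<gamma> = \<beta> + \<delta>"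
      using less by (auto simp: simple_roots_def)
    then show ?thesis
      using less(2) [of \<beta>] less(2) [of \<delta>] positive_inner [of \<beta>] positive_inner [of \<delta>]
      by (simp add: inner_add_left)
  qed (rule assms(2))
qed

text \<open>The product is four times the squared cosine of the angle. Equality in Cauchy-Schwarz
  would make two distinct positive roots proportional, against reducedness.\<close>

lemma cartan_product_less_4:
  assumes "\<alpha> \<in> P" "\<gamma> \<in> P" "\<alpha> \<noteq> \<gamma>"
  shows "cartan_integer \<gamma> \<alpha> * cartan_integer \<alpha> \<gamma> < 4"
proof -
  have \<alpha>: "\<alpha> \<in> \<Delta>" and \<gamma>: "\<gamma> \<in> \<Delta>" using assms positive_subset by auto
  have "(\<alpha> \<bullet> \<gamma>)\<^sup>2 \<noteq> (\<alpha> \<bullet> \<alpha>) * (\<gamma> \<bullet> \<gamma>)"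
  proof
    assume "(\<alpha> \<bullet> \<gamma>)\<^sup>2 = (\<alpha> \<bullet> \<alpha>) * (\<gamma> \<bullet> \<gamma>)"
    define c where "c = (\<alpha> \<bullet> \<gamma>) / (\<alpha> \<bullet> \<alpha>)"
    have "(\<gamma> - c *\<^sub>R \<alpha>) \<bullet> (\<gamma> - c *\<^sub>R \<alpha>) = 0"
      using \<open>(\<alpha> \<bullet> \<gamma>)\<^sup>2 = (\<alpha> \<bullet> \<alpha>) * (\<gamma> \<bullet> \<gamma>)\<close> root_inner_pos [OF \<alpha>]
      by (simp add: c_def inner_diff_left inner_diff_right inner_commute power2_eq_square
          field_simps)
    then have c: "\<gamma> = c *\<^sub>R \<alpha>" by simp
    then have "c = 1 \<or> c = -1" using reduced \<alpha> \<gamma> by blast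
    moreover have "0 < c * (\<alpha> \<bullet> v)" using positive_inner [OF assms(2)] c by simp
    ultimately show False using positive_inner [OF assms(1)] c assms(3) by auto
  qed
  moreover have "(\<alpha> \<bullet> \<gamma>)\<^sup>2 \<le> (\<alpha> \<bullet> \<alpha>) * (\<gamma> \<bullet> \<gamma>)"
    by (rule Cauchy_Schwarz_ineq)
  ultimately have "(\<alpha> \<bullet> \<gamma>)\<^sup>2 < (\<alpha> \<bullet> \<alpha>) * (\<gamma> \<bullet> \<gamma>)" by linarith
  then show ?thesis
    using root_inner_pos [OF \<alpha>] root_inner_pos [OF \<gamma>]
    by (simp add: cartan_integer_def inner_commute divide_simps power2_eq_square)
qed

text \<open>For equal lengths the two Cartan integers coincide, so their square is below 4.\<close>

lemma cartan_integer_less_2: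
  assumes "\<alpha> \<in> P" "\<gamma> \<in> P" "\<alpha> \<noteq> \<gamma>" "\<alpha> \<bullet> \<alpha> = \<gamma> \<bullet> \<gamma>"
  shows "cartan_integer \<gamma> \<alpha> \<le> 1"
proof -
  have \<alpha>: "\<alpha> \<in> \<Delta>" and \<gamma>: "\<gamma> \<in> \<Delta>" using assms positive_subset by auto
  have "cartan_integer \<alpha> \<gamma> = cartan_integer \<gamma> \<alpha>"
    by (simp add: cartan_integer_def assms inner_commute)
  then have "(cartan_integer \<gamma> \<alpha>)\<^sup>2 < 2\<^sup>2"
    using cartan_product_less_4 [OF assms(1-3)] by (simp add: power2_eq_square)
  then have "cartan_integer \<gamma> \<alpha> < 2" by (rule power2_less_imp_less) simp
  moreover obtain k where "cartan_integer \<gamma> \<alpha> = of_int k"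
    using cartan_integer_Ints [OF \<alpha> \<gamma>] by (auto elim: Ints_cases)
  ultimately show ?thesis by simp
qed

text \<open>Otherwise \<open>\<gamma>\<close> and \<open>k\<alpha> - \<gamma>\<close> are positive for some \<open>k \<le> 3\<close>; subtracting \<open>\<alpha>\<close> from one or
  both of them exhibits \<open>\<alpha>\<close> as a sum of two positive roots.\<close>

lemma simple_reflection_positive:
  assumes \<alpha>: "\<alpha> \<in> simple_roots P" and \<gamma>: "\<gamma> \<in> P" and "\<gamma> \<noteq> \<alpha>" and pos: "\<gamma> \<bullet> \<alpha> > 0"
  shows "root_reflection \<alpha> \<gamma> \<in> P"
proof (rule ccontr)
  \<comment> \<open>Under the assumption to be refuted \<delta> is positive too, and \<gamma> +
    \<delta> is the Cartan integer \<open>k\<close> times \<alpha>.\<close>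
  define \<delta> where "\<delta> = - root_reflection \<alpha> \<gamma>"
  assume "root_reflection \<alpha> \<gamma> \<notin> P"
  have \<alpha>\<Delta>: "\<alpha> \<in> \<Delta>" and \<gamma>\<Delta>: "\<gamma> \<in> \<Delta>" and \<alpha>P: "\<alpha> \<in> P"
    using \<alpha> \<gamma> simple_root_root simple_root_positive positive_subset by auto
  have \<delta>: "\<delta> \<in> P"
    using \<open>root_reflection \<alpha> \<gamma> \<notin> P\<close> positive_or_negative root_reflection_in_roots [OF \<alpha>\<Delta> \<gamma>\<Delta>]
    by (auto simp: \<delta>_def)
  obtain k where k: "cartan_integer \<gamma> \<alpha> = of_int k"
    using cartan_integer_Ints [OF \<alpha>\<Delta> \<gamma>\<Delta>] by (auto elim: Ints_cases)
  have sum: "\<gamma> + \<delta> = of_int k *\<^sub>R \<alpha>"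
    by (simp add: \<delta>_def root_reflection_def k)
  \<comment> \<open>The opposite Cartan integer must then be 1, so reflecting \<alpha> in \<beta>
    gives the root \<alpha> - \<beta>, which cannot be positive because \<alpha> is simple.\<close>
  have sub: "\<beta> - \<alpha> \<in> P" if "\<beta> \<in> P" "\<beta> \<noteq> \<alpha>" "\<beta> \<bullet> \<alpha> > 0" "cartan_integer \<beta> \<alpha> \<ge> 2" for \<beta>
  proof -
    have \<beta>: "\<beta> \<in> \<Delta>" using that positive_subset by auto
    have "2 * cartan_integer \<alpha> \<beta> \<le> cartan_integer \<beta> \<alpha> * cartan_integer \<alpha> \<beta>"
      using that root_inner_pos [OF \<beta>]
      by (intro mult_right_mono) (auto simp: cartan_integer_def inner_commute)
    then have "cartan_integer \<alpha> \<beta> < 2"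
      using cartan_product_less_4 [of \<alpha> \<beta>] that \<alpha>P by auto
    moreover have "cartan_integer \<alpha> \<beta> > 0"
      using that root_inner_pos [OF \<beta>] by (simp add: cartan_integer_def inner_commute)
    moreover obtain l where "cartan_integer \<alpha> \<beta> = of_int l"
      using cartan_integer_Ints [OF \<beta> \<alpha>\<Delta>] by (auto elim: Ints_cases)
    ultimately have "cartan_integer \<alpha> \<beta> = 1" by simp
    then have "\<alpha> - \<beta> \<in> \<Delta>"
      using root_reflection_in_roots [OF \<beta> \<alpha>\<Delta>] by (simp add: root_reflection_def)
    then have "\<alpha> - \<beta> \<in> P \<or> \<beta> - \<alpha> \<in> P"
      using positive_or_negative by fastforce
    moreover have "\<alpha> - \<beta> \<notin> P"
      using simple_root_not_sum [of "\<alpha> - \<beta>" \<beta>] \<alpha> that(1) by auto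
    ultimately show ?thesis by blast
  qed
  have "\<delta> \<bullet> \<alpha> = \<gamma> \<bullet> \<alpha>"
    using root_inner_pos [OF \<alpha>\<Delta>]
    by (simp add: \<delta>_def root_reflection_def cartan_integer_def inner_diff_left)
  then have \<delta>k: "cartan_integer \<delta> \<alpha> = of_int k" and \<delta>pos: "\<delta> \<bullet> \<alpha> > 0"
    using k pos by (auto simp: cartan_integer_def)
  \<comment> \<open>Otherwise \<gamma> is \<open>k - 1\<close> times \<alpha>, hence \<alpha> or its
    negative by reducedness.\<close>
  have "\<delta> \<noteq> \<alpha>"
  proof
    assume "\<delta> = \<alpha>"
    then have "\<gamma> = of_int (k - 1) *\<^sub>R \<alpha>" using sum by (simp add: algebra_simps)
    moreover from this have "k = 0 \<or> k = 2" using reduced [OF \<alpha>\<Delta>, of "of_int (k - 1)"] \<gamma>\<Delta>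
      by simp linarith
    ultimately show False using \<open>\<gamma> \<noteq> \<alpha>\<close> positive_inner [OF \<gamma>] positive_inner [OF \<alpha>P] by auto
  qed
  have "cartan_integer \<gamma> \<alpha> > 0"
    using pos root_inner_pos [OF \<alpha>\<Delta>] by (simp add: cartan_integer_def)
  then have "k > 0" using k by simp
  have "k < 4"
  proof -
    have "cartan_integer \<alpha> \<gamma> > 0"
      using pos root_inner_pos [OF \<gamma>\<Delta>] by (simp add: cartan_integer_def inner_commute)
    moreover obtain l where "cartan_integer \<alpha> \<gamma> = of_int l"
      using cartan_integer_Ints [OF \<gamma>\<Delta> \<alpha>\<Delta>] by (auto elim: Ints_cases)
    ultimately have "cartan_integer \<alpha> \<gamma> \<ge> 1" by simp
    then have "of_int k * 1 \<le> of_int k * cartan_integer \<alpha> \<gamma>"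
      using \<open>k > 0\<close> by (intro mult_left_mono) auto
    then have "real_of_int k < 4"
      using cartan_product_less_4 [OF \<alpha>P \<gamma>] \<open>\<gamma> \<noteq> \<alpha>\<close> k by auto
    then show ?thesis by simp
  qed
  consider "k = 1" | "k = 2" | "k = 3" using \<open>k > 0\<close> \<open>k < 4\<close> by linarith
  then show False
  proof cases
    case 1
    then show ?thesis using simple_root_not_sum [of \<gamma> \<delta>] \<alpha> \<gamma> \<delta> sum by simp
  next
    case 2
    have "\<gamma> - \<alpha> + \<delta> = \<alpha>" using sum 2 by (simp add: algebra_simps scaleR_2)
    then show ?thesis
      using simple_root_not_sum [of "\<gamma> - \<alpha>" \<delta>] \<alpha> \<delta> sub [OF \<gamma> \<open>\<gamma> \<noteq> \<alpha>\<close> pos] k 2 by simp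
  next
    case 3
    have "(1 + 1 + 1) *\<^sub>R \<alpha> = \<alpha> + \<alpha> + \<alpha>" by (simp only: scaleR_left_distrib scaleR_one)
    then have "3 *\<^sub>R \<alpha> = \<alpha> + \<alpha> + \<alpha>" by simp
    then have "(\<gamma> - \<alpha>) + (\<delta> - \<alpha>) = \<alpha>" using sum 3 by (simp add: algebra_simps)
    then show ?thesis
      using simple_root_not_sum [of "\<gamma> - \<alpha>" "\<delta> - \<alpha>"] \<alpha> sub [OF \<gamma> \<open>\<gamma> \<noteq> \<alpha>\<close> pos]
        sub [OF \<delta> \<open>\<delta> \<noteq> \<alpha>\<close> \<delta>pos] k \<delta>k 3 by simp
  qed
qed

text \<open>Reflecting in a simple root with positive inner product descends to a lower positive
  root; reflecting back is the induction step. Restricting it to negative Cartan integers limits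
  what a list of roots must be checked for.\<close>

lemma positive_root_induct [consumes 1, case_names simple reflection]:
  assumes "\<gamma> \<in> P"
    and simple: "\<And>\<alpha>. \<alpha> \<in> simple_roots P \<Longrightarrow> Q \<alpha>"
    and step: "\<And>\<alpha> \<beta>. \<lbrakk>\<alpha> \<in> simple_roots P; \<beta> \<in> P; cartan_integer \<beta> \<alpha> < 0; Q \<beta>\<rbrakk> \<Longrightarrow>
      Q (root_reflection \<alpha> \<beta>)"
  shows "Q \<gamma>"
  using assms(1)
proof (induction rule: positive_induct)
  case (less \<gamma>)
  have "\<gamma> \<in> \<Delta>" using less positive_subset by blast
  obtain \<alpha> where \<alpha>: "\<alpha> \<in> simple_roots P" "\<gamma> \<bullet> \<alpha> > 0"
    using positive_inner_nonpos [OF less(1), of \<gamma>] root_inner_pos [OF \<open>\<gamma> \<in> \<Delta>\<close>]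
    by (metis inner_commute not_le)
  have \<alpha>\<Delta>: "\<alpha> \<in> \<Delta>" using \<alpha> simple_root_root by blast
  show ?case
  proof (cases "\<gamma> = \<alpha>")
    case True
    then show ?thesis using simple \<alpha> by simp
  next
    case False
    define \<beta> where "\<beta> = root_reflection \<alpha> \<gamma>"
    have \<beta>: "\<beta> \<in> P" using simple_reflection_positive \<alpha> less(1) False by (simp add: \<beta>_def)
    have c: "cartan_integer \<gamma> \<alpha> > 0"
      using \<alpha> root_inner_pos [OF \<alpha>\<Delta>] by (simp add: cartan_integer_def)
    have "\<beta> \<bullet> v < \<gamma> \<bullet> v"
      using c positive_inner [of \<alpha>] simple_root_positive \<alpha>
      by (simp add: \<beta>_def root_reflection_def inner_diff_left)
    moreover have "cartan_integer \<beta> \<alpha> = - cartan_integer \<gamma> \<alpha>"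
      using root_inner_pos [OF \<alpha>\<Delta>]
      by (simp add: \<beta>_def root_reflection_def cartan_integer_def inner_diff_left field_simps)
    ultimately have "Q (root_reflection \<alpha> \<beta>)"
      using step \<alpha> \<beta> c less(2) by simp
    then show ?thesis by (simp add: \<beta>_def root_reflection_idem [OF root_nonzero [OF \<alpha>\<Delta>]])
  qed
qed

end

context root_chamber
begin

text \<open>A vector \<open>\<omega>\<close> that is no root and at most as long as the roots satisfies
  \<open>\<gamma> \<bullet> \<omega> < n\<close> for every root \<open>\<gamma>\<close>. Distinct roots have inner product at most \<open>n/2\<close>, so \<open>\<omega> - \<gamma>\<close>
  is negative on \<open>\<gamma>\<close> and on no other root \<open>\<beta>\<close> with \<open>2 (\<beta> \<bullet> \<omega>) \<ge> n\<close>.\<close>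

lemma MC_ge_card_simply_laced:
  assumes n: "\<And>\<alpha>. \<alpha> \<in> P \<Longrightarrow> \<alpha> \<bullet> \<alpha> = n" and \<omega>: "\<omega> \<bullet> \<omega> \<le> n" "\<omega> \<notin> P"
  shows "MC \<Delta> P \<ge> card {\<beta> \<in> P. n \<le> 2 * (\<beta> \<bullet> \<omega>)}"
proof (rule MC_ge_card)
  fix \<gamma> assume \<gamma>: "\<gamma> \<in> P"
  have "(\<gamma> - \<omega>) \<bullet> (\<gamma> - \<omega>) > 0"
    using \<gamma> \<omega>(2) by auto
  then have neg: "\<gamma> \<bullet> (\<omega> - \<gamma>) < 0"
    using n [OF \<gamma>] \<omega>(1) by (simp add: inner_diff_left inner_diff_right inner_commute)
  have "\<not> \<beta> \<bullet> (\<omega> - \<gamma>) < 0" if "\<beta> \<in> P" "n \<le> 2 * (\<beta> \<bullet> \<omega>)" "\<beta> \<noteq> \<gamma>" for \<beta>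
  proof -
    have "\<gamma> \<bullet> \<gamma> > 0" using \<gamma> positive_subset root_inner_pos by blast
    then have "2 * (\<beta> \<bullet> \<gamma>) \<le> n"
      using cartan_integer_less_2 [of \<gamma> \<beta>] n that \<gamma> by (simp add: cartan_integer_def)
    then show ?thesis using that(2) by (simp add: inner_diff_right)
  qed
  then show "\<exists>x. \<gamma> \<bullet> x < 0 \<and> (\<forall>\<alpha>\<in>{\<beta> \<in> P. n \<le> 2 * (\<beta> \<bullet> \<omega>)}. \<forall>\<beta>\<in>{\<beta> \<in> P. n \<le> 2 * (\<beta> \<bullet> \<omega>)}.
      \<alpha> \<bullet> x < 0 \<longrightarrow> \<beta> \<bullet> x < 0 \<longrightarrow> \<alpha> = \<beta>)"
    using neg by (intro exI [of _ "\<omega> - \<gamma>"]) blast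
qed auto

end

section \<open>Roots as coefficient vectors\<close>

definition E8_columns :: "int list list" where
  "E8_columns =
    [[2,0,-1,0,0,0,0,0], [0,2,0,-1,0,0,0,0], [-1,0,2,-1,0,0,0,0], [0,-1,-1,2,-1,0,0,0],
     [0,0,0,-1,2,-1,0,0], [0,0,0,0,-1,2,-1,0], [0,0,0,0,0,-1,2,-1], [0,0,0,0,0,0,-1,2]]"

text \<open>Columns are stored because a dot product with column \<open>j\<close> gives the Cartan
  number against one simple root. The matrices of E6 and E7 are leading blocks of that of
  E8.\<close>

fun cartan_columns :: "root_type \<Rightarrow> int list list" where
  "cartan_columns F4 = [[2,-1,0,0], [-1,2,-1,0], [0,-2,2,-1], [0,0,-1,2]]"
| "cartan_columns T = map (take (type_rank T)) (take (type_rank T) E8_columns)"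

definition dot :: "int list \<Rightarrow> int list \<Rightarrow> int" where
  "dot c d = sum_list (map2 (*) c d)"

text \<open>Dynkin labels, that is, coordinates with respect to the fundamental weights.\<close>

definition labels :: "root_type \<Rightarrow> int list \<Rightarrow> int list" where
  "labels T c = map (dot c) (cartan_columns T)"

definition reflect :: "root_type \<Rightarrow> nat \<Rightarrow> int list \<Rightarrow> int list" where
  "reflect T j c = c[j := c ! j - labels T c ! j]"

definition unit_vectors :: "root_type \<Rightarrow> int list list" where
  "unit_vectors T = map (\<lambda>j. (replicate (type_rank T) 0)[j := 1]) [0..<type_rank T]"

text \<open>A checkable certificate that all entries are positive roots: each is simple or one
  simple reflection away from a later entry, and nonnegativity fixes the sign.\<close>

fun reachable :: "root_type \<Rightarrow> int list list \<Rightarrow> bool" where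
  "reachable T [] \<longleftrightarrow> True"
| "reachable T (c # L) \<longleftrightarrow> length c = type_rank T \<and> list_all (\<lambda>k. 0 \<le> k) c \<and>
     (c \<in> set (unit_vectors T) \<or> list_ex (\<lambda>j. reflect T j c \<in> set L) [0..<type_rank T]) \<and>
     reachable T L"

lemma length_cartan_columns: "length (cartan_columns T) = type_rank T"
  by (cases T) (simp_all add: E8_columns_def)

lemma length_labels [simp]: "length (labels T c) = type_rank T"
  by (simp add: labels_def length_cartan_columns)

lemma length_reflect [simp]: "length (reflect T j c) = length c"
  by (simp add: reflect_def)

lemma dot_eq_sum:
  assumes "length c = r" "length d = r"
  shows "dot c d = (\<Sum>i<r. c ! i * d ! i)"
  using assms by (simp add: dot_def sum_list_sum_nth atLeast0LessThan)

lemma cartan_columns_nth: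
  assumes "i < type_rank T" "j < type_rank T"
  shows "cartan_columns T ! j ! i = cartan_matrix T (Suc i) (Suc j)"
proof -
  have "list_all (\<lambda>j. list_all (\<lambda>i. cartan_columns T ! j ! i = cartan_matrix T (Suc i) (Suc j))
      [0..<type_rank T]) [0..<type_rank T]"
    by (induct T; code_simp)
  then show ?thesis using assms by (simp add: list_all_iff)
qed

lemma length_cartan_column:
  assumes "j < type_rank T"
  shows "length (cartan_columns T ! j) = type_rank T"
proof -
  have "list_all (\<lambda>col. length col = type_rank T) (cartan_columns T)"
    by (cases T) (simp_all add: E8_columns_def)
  then show ?thesis using assms by (simp add: list_all_length length_cartan_columns)
qed

lemma labels_nth:
  assumes "length c = type_rank T" "j < type_rank T"
  shows "labels T c ! j = (\<Sum>i<type_rank T. c ! i * cartan_matrix T (Suc i) (Suc j))"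
  using assms
  by (simp add: labels_def length_cartan_columns dot_eq_sum [OF _ length_cartan_column]
      cartan_columns_nth)

section \<open>Realising coefficient vectors in a given root system\<close>

locale typed_root_chamber = root_chamber \<Delta> P v
  for \<Delta> P :: "'a::euclidean_space set" and v +
  fixes T :: root_type and s :: "nat \<Rightarrow> 'a"
  assumes simple: "bij_betw s {1..type_rank T} (simple_roots P)"
    and cartan: "\<And>i j. \<lbrakk>i \<in> {1..type_rank T}; j \<in> {1..type_rank T}\<rbrakk> \<Longrightarrow>
      cartan_integer (s i) (s j) = of_int (cartan_matrix T i j)"
begin

text \<open>List positions start at 0 and Bourbaki's labels at 1, whence the shift by
  \<open>Suc\<close>.\<close>

definition comb :: "int list \<Rightarrow> 'a" where
  "comb c = (\<Sum>i<type_rank T. of_int (c ! i) *\<^sub>R s (Suc i))"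

lemma s_simple: "j < type_rank T \<Longrightarrow> s (Suc j) \<in> simple_roots P"
  using bij_betw_apply [OF simple] by auto

lemma s_root: "j < type_rank T \<Longrightarrow> s (Suc j) \<in> \<Delta>"
  using s_simple simple_root_root by blast

lemma simple_root_obtain:
  assumes "\<alpha> \<in> simple_roots P"
  obtains j where "j < type_rank T" "\<alpha> = s (Suc j)"
proof -
  obtain i where "i \<in> {1..type_rank T}" "\<alpha> = s i"
    using bij_betw_imp_surj_on [OF simple] assms by blast
  then show ?thesis using that [of "i - 1"] by auto
qed

lemma cartan_integer_comb:
  assumes "length c = type_rank T" "j < type_rank T"
  shows "cartan_integer (comb c) (s (Suc j)) = of_int (labels T c ! j)"
proof -
  have "cartan_integer (comb c) (s (Suc j)) =
      (\<Sum>i<type_rank T. of_int (c ! i) * cartan_integer (s (Suc i)) (s (Suc j)))"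
    by (simp add: cartan_integer_def comb_def inner_sum_left sum_distrib_left sum_divide_distrib
        mult_ac)
  also have "\<dots> = of_int (labels T c ! j)"
    using assms by (simp add: labels_nth cartan)
  finally show ?thesis .
qed

lemma inner_comb_simple:
  assumes "length c = type_rank T" "j < type_rank T"
  shows "2 * (comb c \<bullet> s (Suc j)) = of_int (labels T c ! j) * (s (Suc j) \<bullet> s (Suc j))"
  using cartan_integer_comb [OF assms] root_nonzero [OF s_root [OF assms(2)]]
  by (simp add: cartan_integer_def field_simps)

lemma root_reflection_comb:
  assumes "length c = type_rank T" "j < type_rank T"
  shows "root_reflection (s (Suc j)) (comb c) = comb (reflect T j c)"
proof -
  have "comb (reflect T j c) = (\<Sum>i<type_rank T. of_int (c ! i) *\<^sub>R s (Suc i) -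
      (if i = j then of_int (labels T c ! j) *\<^sub>R s (Suc j) else 0))"
    unfolding comb_def
    by (intro sum.cong) (auto simp: reflect_def assms nth_list_update scaleR_diff_left)
  also have "\<dots> = comb c - of_int (labels T c ! j) *\<^sub>R s (Suc j)"
    using assms(2) by (simp add: sum_subtractf comb_def)
  finally show ?thesis
    by (simp add: root_reflection_def cartan_integer_comb assms)
qed

lemma comb_unit_vector:
  assumes "j < type_rank T"
  shows "comb ((replicate (type_rank T) 0)[j := 1]) = s (Suc j)"
proof -
  have "comb ((replicate (type_rank T) 0)[j := 1]) =
      (\<Sum>i<type_rank T. if i = j then s (Suc j) else 0)"
    unfolding comb_def by (intro sum.cong) (auto simp: nth_list_update)
  then show ?thesis using assms by simp
qed

lemma reachable_length: "\<lbrakk>reachable T L; c \<in> set L\<rbrakk> \<Longrightarrow> length c = type_rank T"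
  by (induction L) auto

lemma reachable_root: "\<lbrakk>reachable T L; c \<in> set L\<rbrakk> \<Longrightarrow> comb c \<in> \<Delta>"
proof (induction L arbitrary: c)
  case (Cons d L)
  have "comb d \<in> \<Delta>"
  proof (cases "d \<in> set (unit_vectors T)")
    case True
    then show ?thesis by (auto simp: unit_vectors_def comb_unit_vector s_root)
  next
    case False
    then obtain j where j: "j < type_rank T" "reflect T j d \<in> set L"
      using Cons.prems by (auto simp: list_ex_iff)
    have d: "length d = type_rank T" using Cons.prems by simp
    have "root_reflection (s (Suc j)) (comb (reflect T j d)) \<in> \<Delta>"
      using j Cons by (intro root_reflection_in_roots s_root) auto
    also have "root_reflection (s (Suc j)) (comb (reflect T j d)) = comb d"
      using root_nonzero [OF s_root [OF j(1)]]
      by (simp add: root_reflection_comb [OF d j(1), symmetric] root_reflection_idem)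
    finally show ?thesis .
  qed
  then show ?case using Cons by auto
qed simp

lemma reachable_positive:
  assumes L: "reachable T L" and c: "c \<in> set L"
  shows "comb c \<in> P"
proof -
  have "list_all (\<lambda>k. 0 \<le> k) c" using assms by (induction L) auto
  then have "c ! i \<ge> 0" if "i < type_rank T" for i
    using that reachable_length [OF assms] by (simp add: list_all_length)
  moreover have "s (Suc i) \<bullet> v \<ge> 0" if "i < type_rank T" for i
    using that s_simple simple_root_positive positive_inner less_imp_le by blast
  ultimately have "comb c \<bullet> v \<ge> 0"
    by (auto simp: comb_def inner_sum_left intro!: sum_nonneg mult_nonneg_nonneg)
  then show ?thesis
    using regular [OF reachable_root [OF assms]] reachable_root [OF assms] by (simp add: positive)
qed

text \<open>Labels are Cartan numbers of the vector itself, so distinct labels separate vectors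
  without an appeal to linear independence of the simple roots.\<close>

lemma inj_on_comb:
  assumes "reachable T L" "distinct (map (labels T) L)"
  shows "inj_on comb (set L)"
proof (rule inj_onI)
  fix c d assume cd: "c \<in> set L" "d \<in> set L" "comb c = comb d"
  have "labels T c = labels T d"
  proof (rule nth_equalityI)
    fix j assume "j < length (labels T c)"
    then have j: "j < type_rank T" by simp
    have "real_of_int (labels T c ! j) = of_int (labels T d ! j)"
      using cartan_integer_comb [OF reachable_length [OF assms(1) cd(1)] j]
        cartan_integer_comb [OF reachable_length [OF assms(1) cd(2)] j] cd(3) by simp
    then show "labels T c ! j = labels T d ! j" by simp
  qed simp
  then show "c = d" using assms(2) cd by (auto simp: distinct_map inj_on_def)
qed

section \<open>Root lengths and the bound for the simply laced types\<close>

lemma inner_comb_comb: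
  assumes n: "\<And>j. j < type_rank T \<Longrightarrow> s (Suc j) \<bullet> s (Suc j) = n"
    and "length c = type_rank T" "length d = type_rank T"
  shows "2 * (comb c \<bullet> comb d) = of_int (dot d (labels T c)) * n"
proof -
  have "2 * (comb c \<bullet> comb d) =
      (\<Sum>j<type_rank T. of_int (d ! j) * (2 * (comb c \<bullet> s (Suc j))))"
    by (simp add: comb_def [of d] inner_sum_right sum_distrib_left mult_ac)
  also have "\<dots> = (\<Sum>j<type_rank T. of_int (d ! j) * (of_int (labels T c ! j) * n))"
    using assms by (intro sum.cong) (auto simp: inner_comb_simple)
  also have "\<dots> = of_int (dot d (labels T c)) * n"
    using assms by (simp add: dot_eq_sum sum_distrib_right mult.assoc)
  finally show ?thesis .
qed

lemma adjacent_same_length: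
  assumes "T \<noteq> F4" "{i, j} \<in> E_edges" "i \<noteq> j" "i \<in> {1..type_rank T}" "j \<in> {1..type_rank T}"
  shows "s i \<bullet> s i = s j \<bullet> s j"
proof -
  have "cartan_integer (s i) (s j) = -1" "cartan_integer (s j) (s i) = -1"
    using assms cartan by (simp_all add: cartan_matrix_def insert_commute)
  \<comment> \<open>Division by zero yields 0, so a Cartan number -1 already excludes a zero
    length.\<close>
  moreover from this have "s i \<bullet> s i \<noteq> 0" "s j \<bullet> s j \<noteq> 0"
    by (auto simp: cartan_integer_def)
  ultimately show ?thesis by (simp add: cartan_integer_def inner_commute field_simps)
qed

text \<open>The diagram is connected: equality of lengths spreads from node 1 along the edges, with
  nodes 7 and 8 present only in the larger types.\<close>

lemma simple_same_length:
  assumes "T \<noteq> F4" "j < type_rank T"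
  shows "s (Suc j) \<bullet> s (Suc j) = s 1 \<bullet> s 1"
proof -
  have r: "type_rank T \<in> {6, 7, 8}" using assms(1) by (cases T) auto
  have edge: "s a \<bullet> s a = s b \<bullet> s b" if "{a, b} \<in> E_edges" "a \<noteq> b" "1 \<le> a" "1 \<le> b"
    "a \<le> type_rank T" "b \<le> type_rank T" for a b
    using adjacent_same_length [of a b] that assms(1) by simp
  have 3: "s 3 \<bullet> s 3 = s 1 \<bullet> s 1" and 4: "s 4 \<bullet> s 4 = s 3 \<bullet> s 3"
    and 2: "s 2 \<bullet> s 2 = s 4 \<bullet> s 4" and 5: "s 5 \<bullet> s 5 = s 4 \<bullet> s 4"
    and 6: "s 6 \<bullet> s 6 = s 5 \<bullet> s 5"
    using r by (auto intro!: edge simp: E_edges_def doubleton_eq_iff)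
  have 7: "s 7 \<bullet> s 7 = s 6 \<bullet> s 6" if "7 \<le> type_rank T"
    using that by (auto intro!: edge simp: E_edges_def doubleton_eq_iff)
  have 8: "s 8 \<bullet> s 8 = s 7 \<bullet> s 7" if "8 \<le> type_rank T"
    using that by (auto intro!: edge simp: E_edges_def doubleton_eq_iff)
  have "j < 8" using assms(2) r by auto
  then consider "j = 0" | "j = 1" | "j = 2" | "j = 3" | "j = 4" | "j = 5" | "j = 6" | "j = 7"
    by linarith
  then show ?thesis using 2 3 4 5 6 7 8 assms(2) by cases (simp_all add: numeral_eq_Suc)
qed

lemma positive_same_length:
  assumes "T \<noteq> F4" "\<gamma> \<in> P"
  shows "\<gamma> \<bullet> \<gamma> = s 1 \<bullet> s 1"
  using assms(2)
proof (induction rule: positive_root_induct)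
  case (simple \<alpha>)
  then show ?case using simple_same_length [OF assms(1)] by (metis simple_root_obtain)
next
  case (reflection \<alpha> \<beta>)
  then show ?case by (simp add: inner_root_reflection root_nonzero simple_root_root)
qed

text \<open>\<open>MC_ge_card_simply_laced\<close> for the vector \<open>\<omega>\<close> with coefficients \<open>d / q\<close>; an integrality
  test serves to see that \<open>\<omega>\<close> is no root when it has the same length as the roots.\<close>

lemma MC_ge_E:
  assumes T: "T \<noteq> F4"
    and L: "reachable T L" "distinct (map (labels T) L)"
    and d: "length d = type_rank T" and q: "q > 0"
    and \<omega>: "dot d (labels T d) < 2 * q\<^sup>2 \<or>
      dot d (labels T d) = 2 * q\<^sup>2 \<and> list_ex (\<lambda>k. \<not> q dvd k) (labels T d)"
  shows "MC \<Delta> P \<ge> length (filter (\<lambda>c. q \<le> dot d (labels T c)) L)"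
proof -
  define n where "n = s 1 \<bullet> s 1"
  define \<omega> where "\<omega> = (1 / of_int q) *\<^sub>R comb d"
  have ns: "s (Suc j) \<bullet> s (Suc j) = n" if "j < type_rank T" for j
    using simple_same_length [OF T that] by (simp add: n_def)
  have "n > 0" using ns [of 0] root_inner_pos [OF s_root, of 0] by (cases T) auto
  have \<omega>\<omega>: "2 * (of_int q)\<^sup>2 * (\<omega> \<bullet> \<omega>) = of_int (dot d (labels T d)) * n"
    using inner_comb_comb [OF ns d d] q by (simp add: \<omega>_def power2_eq_square)
  \<comment> \<open>By the preceding formula, the bound \<open>2 * q\<^sup>2\<close> on the integer
    form says that \<omega> is no longer than a root.\<close>
  have le: "\<omega> \<bullet> \<omega> \<le> n"
  proof -
    have "real_of_int (dot d (labels T d)) \<le> of_int (2 * q\<^sup>2)" using \<omega> by linarith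
    then have "2 * (of_int q)\<^sup>2 * (\<omega> \<bullet> \<omega>) \<le> 2 * (of_int q)\<^sup>2 * n"
      unfolding \<omega>\<omega> using \<open>n > 0\<close> by (intro mult_right_mono) auto
    then show ?thesis using q by simp
  qed
  have "\<omega> \<notin> P"
  proof
    assume "\<omega> \<in> P"
    then have "\<omega> \<bullet> \<omega> = n" using positive_same_length [OF T] by (simp add: n_def)
    then have "real_of_int (dot d (labels T d)) = of_int (2 * q\<^sup>2)"
      using \<omega>\<omega> \<open>n > 0\<close> by simp
    then have "dot d (labels T d) = 2 * q\<^sup>2" by (simp only: of_int_eq_iff)
    \<comment> \<open>For a root \<omega> all labels of \<open>d\<close> divided by \<open>q\<close>
      would be Cartan integers.\<close>
    then obtain j where j: "j < type_rank T" "\<not> q dvd labels T d ! j"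
      using \<omega> by (auto simp: list_ex_length)
    have "\<omega> \<in> \<Delta>" using \<open>\<omega> \<in> P\<close> positive_subset by blast
    then obtain k where "cartan_integer \<omega> (s (Suc j)) = of_int k"
      using cartan_integer_Ints [OF s_root [OF j(1)]] by (auto elim: Ints_cases)
    moreover have "cartan_integer \<omega> (s (Suc j)) = cartan_integer (comb d) (s (Suc j)) / of_int q"
      by (simp add: \<omega>_def cartan_integer_def)
    ultimately have "real_of_int (labels T d ! j) = of_int (q * k)"
      using q by (simp add: cartan_integer_comb [OF d j(1)] field_simps)
    then show False using j(2) by (metis dvd_triv_left of_int_eq_iff)
  qed
  define F where "F = filter (\<lambda>c. q \<le> dot d (labels T c)) L"
  \<comment> \<open>An inclusion suffices for a lower bound, so \<open>L\<close> may list only some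
    of the positive roots.\<close>
  have "comb c \<in> {\<beta> \<in> P. n \<le> 2 * (\<beta> \<bullet> \<omega>)}" if "c \<in> set F" for c
  proof -
    have c: "c \<in> set L" "q \<le> dot d (labels T c)" using that by (auto simp: F_def)
    have "2 * (comb c \<bullet> \<omega>) = of_int (dot d (labels T c)) / of_int q * n"
      using inner_comb_comb [OF ns reachable_length [OF L(1) c(1)] d] by (simp add: \<omega>_def)
    moreover have "1 * n \<le> of_int (dot d (labels T c)) / of_int q * n"
      using \<open>n > 0\<close> c(2) q by (intro mult_right_mono) auto
    ultimately show ?thesis using reachable_positive [OF L(1) c(1)] by simp
  qed
  then have "card (comb ` set F) \<le> card {\<beta> \<in> P. n \<le> 2 * (\<beta> \<bullet> \<omega>)}"
    using finite_positive by (intro card_mono) auto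
  moreover have "inj_on comb (set F)"
    using inj_on_comb [OF L] by (rule inj_on_subset) (auto simp: F_def)
  moreover have "distinct F"
    using L(2) by (simp add: F_def distinct_map)
  ultimately have "length F \<le> card {\<beta> \<in> P. n \<le> 2 * (\<beta> \<bullet> \<omega>)}"
    by (simp add: card_image distinct_card)
  also have "\<dots> \<le> MC \<Delta> P"
    using positive_same_length [OF T] le \<open>\<omega> \<notin> P\<close>
    by (intro MC_ge_card_simply_laced) (auto simp: n_def)
  finally show ?thesis by (simp add: F_def)
qed

text \<open>Completeness of a list becomes a finite check, since \<open>positive_root_induct\<close>
  generates all positive roots by exactly these reflections.\<close>

lemma positive_in_list:
  assumes L: "\<And>c. c \<in> set L \<Longrightarrow> length c = type_rank T"
    and units: "set (unit_vectors T) \<subseteq> set L"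
    and closed: "\<And>c j. \<lbrakk>c \<in> set L; j < type_rank T; labels T c ! j < 0\<rbrakk> \<Longrightarrow> reflect T j c \<in> set L"
    and "\<gamma> \<in> P"
  shows "\<gamma> \<in> comb ` set L"
  using assms(4)
proof (induction rule: positive_root_induct)
  case (simple \<alpha>)
  then obtain j where j: "j < type_rank T" "\<alpha> = s (Suc j)" by (rule simple_root_obtain)
  then have "(replicate (type_rank T) 0)[j := 1] \<in> set L"
    using units by (auto simp: unit_vectors_def)
  then show ?case using j comb_unit_vector by (metis imageI)
next
  case (reflection \<alpha> \<beta>)
  then obtain c where c: "c \<in> set L" "\<beta> = comb c" by blast
  obtain j where j: "j < type_rank T" "\<alpha> = s (Suc j)"
    using reflection(1) by (rule simple_root_obtain)
  have "labels T c ! j < 0"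
    using reflection(3) cartan_integer_comb [OF L [OF c(1)] j(1)] c j by simp
  then have "reflect T j c \<in> set L" using closed c j by blast
  moreover have "root_reflection \<alpha> \<beta> = comb (reflect T j c)"
    using root_reflection_comb [OF L [OF c(1)] j(1)] c j by simp
  ultimately show ?case by blast
qed

text \<open>The computational form of \<open>MC_ge_card\<close>: \<open>closed\<close> and
  \<open>units\<close> make \<open>L\<close> the full list of positive roots, and \<open>Y\<close>
  supplies the vectors. It makes no assumption on root lengths and so applies to F4.\<close>

lemma MC_ge_covering:
  assumes L: "reachable T L" "distinct (map (labels T) L)"
    and units: "list_all (\<lambda>c. c \<in> set L) (unit_vectors T)"
    and closed: "list_all (\<lambda>c. list_all (\<lambda>j. labels T c ! j < 0 \<longrightarrow> reflect T j c \<in> set L)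
      [0..<type_rank T]) L"
    and S: "distinct S" "list_all (\<lambda>c. c \<in> set L) S"
    and Y: "list_all (\<lambda>y. length y = type_rank T \<and>
      length (filter (\<lambda>c. dot y (labels T c) < 0) S) \<le> 1) Y"
    and cover: "list_all (\<lambda>c. list_ex (\<lambda>y. dot y (labels T c) < 0) Y) L"
  shows "MC \<Delta> P \<ge> length S"
proof -
  have SL: "set S \<subseteq> set L" using S(2) by (auto simp: list_all_iff)
  have "MC \<Delta> P \<ge> card (comb ` set S)"
  proof (rule MC_ge_card)
    show "comb ` set S \<subseteq> P" using SL reachable_positive [OF L(1)] by blast
    fix \<gamma> assume "\<gamma> \<in> P"
    then have "\<gamma> \<in> comb ` set L"
      using units closed reachable_length [OF L(1)]
      by (intro positive_in_list) (auto simp: list_all_iff)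
    then obtain c where c: "c \<in> set L" "\<gamma> = comb c" by blast
    then obtain y where y: "y \<in> set Y" "dot y (labels T c) < 0"
      using cover by (auto simp: list_all_iff list_ex_iff)
    have len: "length y = type_rank T"
      and one: "length (filter (\<lambda>c. dot y (labels T c) < 0) S) \<le> 1"
      using Y y by (auto simp: list_all_iff)
    \<comment> \<open>The coefficients \<open>y\<close> refer to simple coroots, so the pairing with
      a root is the integer \<open>dot y\<close> of its labels, whatever the root lengths
      are.\<close>
    define x where
      "x = (\<Sum>j<type_rank T. (2 * of_int (y ! j) / (s (Suc j) \<bullet> s (Suc j))) *\<^sub>R s (Suc j))"
    have x: "comb a \<bullet> x = of_int (dot y (labels T a))" if "a \<in> set L" for a
    proof -
      have "comb a \<bullet> x = (\<Sum>j<type_rank T. of_int (y ! j) * cartan_integer (comb a) (s (Suc j)))"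
        by (simp add: x_def inner_sum_right cartan_integer_def mult_ac)
      also have "\<dots> = of_int (dot y (labels T a))"
        using reachable_length [OF L(1) that] len by (simp add: cartan_integer_comb dot_eq_sum)
      finally show ?thesis .
    qed
    have "card {a \<in> set S. dot y (labels T a) < 0} \<le> 1"
      using one S(1) by (simp add: distinct_length_filter Int_def conj_commute)
    then have "a = b" if "a \<in> set S" "b \<in> set S" "dot y (labels T a) < 0" "dot y (labels T b) < 0" for a b
      using that card_le_Suc0_iff_eq [of "{a \<in> set S. dot y (labels T a) < 0}"] by auto
    moreover have "comb a \<bullet> x < 0 \<longleftrightarrow> dot y (labels T a) < 0" if "a \<in> set S" for a
      using x [of a] that SL by auto
    ultimately have "\<forall>\<alpha>\<in>comb ` set S. \<forall>\<beta>\<in>comb ` set S. \<alpha> \<bullet> x < 0 \<longrightarrow> \<beta> \<bullet> x < 0 \<longrightarrow> \<alpha> = \<beta>"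
      by blast
    then show "\<exists>x. \<gamma> \<bullet> x < 0 \<and> (\<forall>\<alpha>\<in>comb ` set S. \<forall>\<beta>\<in>comb ` set S.
        \<alpha> \<bullet> x < 0 \<longrightarrow> \<beta> \<bullet> x < 0 \<longrightarrow> \<alpha> = \<beta>)"
      using x [OF c(1)] y(2) c(2) by (intro exI [of _ x]) simp
  qed
  moreover have "inj_on comb (set S)"
    using inj_on_comb [OF L] SL by (rule inj_on_subset)
  ultimately show ?thesis using S(1) by (simp add: card_image distinct_card)
qed

end

section \<open>The exceptional types\<close>

text \<open>All 24 positive roots by decreasing height, so that a reflection lowering the height
  leads to a later entry.\<close>

definition F4_positive :: "int list list" where
  "F4_positive = [
    [2,3,4,2], [1,3,4,2], [1,2,4,2], [1,2,3,2], [1,2,2,2], [1,2,3,1], [1,1,2,2], [1,2,2,1],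
    [0,1,2,2], [1,1,2,1], [1,2,2,0], [0,1,2,1], [1,1,1,1], [1,1,2,0], [0,1,1,1], [0,1,2,0],
    [1,1,1,0], [0,0,1,1], [0,1,1,0], [1,1,0,0], [0,0,0,1], [0,0,1,0], [0,1,0,0], [1,0,0,0]]"

text \<open>The roots with coefficient 1 at the first simple root. Three times the first fundamental
  weight pairs with them to 3, the threshold used below.\<close>

definition E6_roots :: "int list list" where
  "E6_roots = [
    [1,2,2,3,2,1], [1,1,2,3,2,1], [1,1,2,2,2,1], [1,1,1,2,2,1], [1,1,2,2,1,1], [1,1,1,2,1,1],
    [1,1,2,2,1,0], [1,1,1,1,1,1], [1,1,1,2,1,0], [1,0,1,1,1,1], [1,1,1,1,1,0], [1,0,1,1,1,0],
    [1,1,1,1,0,0], [1,0,1,1,0,0], [1,0,1,0,0,0], [1,0,0,0,0,0]]"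

text \<open>The roots with coefficient 1 at the seventh simple root; twice the seventh fundamental
  weight pairs with them to 2.\<close>

definition E7_roots :: "int list list" where
  "E7_roots = [
    [2,2,3,4,3,2,1], [1,2,3,4,3,2,1], [1,2,2,4,3,2,1], [1,2,2,3,3,2,1], [1,1,2,3,3,2,1],
    [1,2,2,3,2,2,1], [1,1,2,3,2,2,1], [1,2,2,3,2,1,1], [1,1,2,2,2,2,1], [1,1,2,3,2,1,1],
    [1,1,1,2,2,2,1], [1,1,2,2,2,1,1], [0,1,1,2,2,2,1], [1,1,1,2,2,1,1], [1,1,2,2,1,1,1],
    [0,1,1,2,2,1,1], [1,1,1,2,1,1,1], [0,1,1,2,1,1,1], [1,1,1,1,1,1,1], [0,1,1,1,1,1,1],
    [1,0,1,1,1,1,1], [0,0,1,1,1,1,1], [0,1,0,1,1,1,1], [0,0,0,1,1,1,1], [0,0,0,0,1,1,1],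
    [0,0,0,0,0,1,1], [0,0,0,0,0,0,1]]"

text \<open>Only the first 36 of these roots count; the others link them to a simple root.\<close>

definition E8_roots :: "int list list" where
  "E8_roots = [
    [2,3,4,6,5,4,3,2], [2,3,4,6,5,4,3,1], [2,3,4,6,5,4,2,1], [2,3,4,6,5,3,2,1],
    [2,3,4,6,4,3,2,1], [2,3,4,5,4,3,2,1], [2,2,4,5,4,3,2,1], [2,3,3,5,4,3,2,1],
    [1,3,3,5,4,3,2,1], [2,2,3,5,4,3,2,1], [1,2,3,5,4,3,2,1], [2,2,3,4,4,3,2,1],
    [1,2,3,4,4,3,2,1], [2,2,3,4,3,3,2,1], [1,2,2,4,4,3,2,1], [1,2,3,4,3,3,2,1],
    [2,2,3,4,3,2,2,1], [1,2,2,4,3,3,2,1], [1,2,3,4,3,2,2,1], [2,2,3,4,3,2,1,1],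
    [1,2,2,3,3,3,2,1], [1,2,2,4,3,2,2,1], [1,2,3,4,3,2,1,1], [2,2,3,4,3,2,1,0],
    [1,2,2,3,3,2,2,1], [1,2,2,4,3,2,1,1], [1,2,3,4,3,2,1,0], [1,2,2,3,2,2,2,1],
    [1,2,2,3,3,2,1,1], [1,2,2,4,3,2,1,0], [1,2,2,3,2,2,1,1], [1,2,2,3,3,2,1,0],
    [1,2,2,3,2,1,1,1], [1,2,2,3,2,2,1,0], [1,2,2,3,2,1,1,0], [1,2,2,3,2,1,0,0],
    [1,1,2,3,2,1,0,0], [1,1,2,2,2,1,0,0], [1,1,1,2,2,1,0,0], [0,1,1,2,2,1,0,0],
    [0,1,1,2,1,1,0,0], [0,1,1,1,1,1,0,0], [0,0,1,1,1,1,0,0], [0,0,0,1,1,1,0,0],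
    [0,0,0,0,1,1,0,0], [0,0,0,0,0,1,0,0]]"

text \<open>Six roots and, in coroot coordinates, six vectors, each of them negative on exactly one of the
  six roots; both were found by a computer search.\<close>

definition F4_separated :: "int list list" where
  "F4_separated = [[0,0,0,1], [0,0,1,1], [1,1,1,1], [0,1,2,2], [1,2,2,2], [1,2,3,1]]"

definition F4_separators :: "int list list" where
  "F4_separators = [[1,0,0,0], [-1,0,0,0], [0,1,0,0], [0,-1,0,0], [5,11,9,4], [-3,-6,-4,-1]]"

lemma irreducible_root_system_typed:
  assumes "irreducible_root_system_of_type T \<Delta> P"
  obtains v s where "typed_root_chamber \<Delta> P v T s"
proof -
  obtain v where "\<And>\<alpha>. \<alpha> \<in> \<Delta> \<Longrightarrow> \<alpha> \<bullet> v \<noteq> 0" "P = {\<alpha> \<in> \<Delta>. \<alpha> \<bullet> v > 0}"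
    using assms by (auto simp: irreducible_root_system_of_type_def positive_system_def)
  moreover obtain s where "bij_betw s {1..type_rank T} (simple_roots P)"
    "\<And>i j. \<lbrakk>i \<in> {1..type_rank T}; j \<in> {1..type_rank T}\<rbrakk> \<Longrightarrow>
      cartan_integer (s i) (s j) = of_int (cartan_matrix T i j)"
    using assms unfolding irreducible_root_system_of_type_def has_type_def by blast
  moreover have "crystallographic_root_system \<Delta>"
    using assms by (simp add: irreducible_root_system_of_type_def)
  ultimately have "typed_root_chamber \<Delta> P v T s" by unfold_locales auto
  then show ?thesis by (rule that)
qed

section \<open>The bounds type by type\<close>

lemma MC_E6:
  assumes "irreducible_root_system_of_type E6 \<Delta> P"
  shows "MC \<Delta> P \<ge> 16"
proof -
  obtain v s where "typed_root_chamber \<Delta> P v E6 s"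
    using assms by (rule irreducible_root_system_typed)
  then interpret typed_root_chamber \<Delta> P v E6 s .
  \<comment> \<open>The first fundamental weight, of squared length \<open>4/3\<close> when the roots have squared length 2.\<close>
  have "length (filter (\<lambda>c. 3 \<le> dot [4,3,5,6,4,2] (labels E6 c)) E6_roots) \<le> MC \<Delta> P"
    by (rule MC_ge_E) code_simp+
  moreover have "length (filter (\<lambda>c. 3 \<le> dot [4,3,5,6,4,2] (labels E6 c)) E6_roots) = 16"
    by code_simp
  ultimately show ?thesis by simp
qed

lemma MC_E7:
  assumes "irreducible_root_system_of_type E7 \<Delta> P"
  shows "MC \<Delta> P \<ge> 27"
proof -
  obtain v s where "typed_root_chamber \<Delta> P v E7 s"
    using assms by (rule irreducible_root_system_typed)
  then interpret typed_root_chamber \<Delta> P v E7 s .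
  \<comment> \<open>The seventh fundamental weight, of squared length \<open>3/2\<close>.\<close>
  have "length (filter (\<lambda>c. 2 \<le> dot [2,3,4,6,5,4,3] (labels E7 c)) E7_roots) \<le> MC \<Delta> P"
    by (rule MC_ge_E) code_simp+
  moreover have "length (filter (\<lambda>c. 2 \<le> dot [2,3,4,6,5,4,3] (labels E7 c)) E7_roots) = 27"
    by code_simp
  ultimately show ?thesis by simp
qed

lemma MC_E8:
  assumes "irreducible_root_system_of_type E8 \<Delta> P"
  shows "MC \<Delta> P \<ge> 36"
proof -
  obtain v s where "typed_root_chamber \<Delta> P v E8 s"
    using assms by (rule irreducible_root_system_typed)
  then interpret typed_root_chamber \<Delta> P v E8 s .
  \<comment> \<open>Half the second fundamental weight is as long as a root, but has a half-integral Cartan number.\<close>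
  have "length (filter (\<lambda>c. 2 \<le> dot [5,8,10,15,12,9,6,3] (labels E8 c)) E8_roots) \<le> MC \<Delta> P"
    by (rule MC_ge_E) code_simp+
  \<comment> \<open>The second fundamental weight reads off the second coefficient, which is 2 or 3
    for the 36 roots and at most 1 for the linking ones.\<close>
  moreover have "length (filter (\<lambda>c. 2 \<le> dot [5,8,10,15,12,9,6,3] (labels E8 c)) E8_roots) = 36"
    by code_simp
  ultimately show ?thesis by simp
qed

lemma MC_F4:
  assumes "irreducible_root_system_of_type F4 \<Delta> P"
  shows "MC \<Delta> P \<ge> 6"
proof -
  obtain v s where "typed_root_chamber \<Delta> P v F4 s"
    using assms by (rule irreducible_root_system_typed)
  then interpret typed_root_chamber \<Delta> P v F4 s .
  have "length F4_separated \<le> MC \<Delta> P"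
    by (rule MC_ge_covering [of F4_positive _ F4_separators]) code_simp+
  then show ?thesis by (simp add: F4_separated_def)
qed

theorem mainTheorem4:
  shows "(\<forall>(\<Delta> :: 'a::euclidean_space set) P.
            irreducible_root_system_of_type F4 \<Delta> P \<longrightarrow> MC \<Delta> P \<ge> 6) \<and>
         (\<forall>(\<Delta> :: 'b::euclidean_space set) P.
            irreducible_root_system_of_type E6 \<Delta> P \<longrightarrow> MC \<Delta> P \<ge> 16) \<and>
         (\<forall>(\<Delta> :: 'c::euclidean_space set) P.
            irreducible_root_system_of_type E7 \<Delta> P \<longrightarrow> MC \<Delta> P \<ge> 27) \<and>
         (\<forall>(\<Delta> :: 'd::euclidean_space set) P.
            irreducible_root_system_of_type E8 \<Delta> P \<longrightarrow> MC \<Delta> P \<ge> 36)"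
  using MC_F4 MC_E6 MC_E7 MC_E8 by blast

end
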